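(* The function $\|\cdot\|_2 : \mathbb{DQ}^n \to \mathbb{D}$ defined for $\mathbf{x} = (x_1,\dots,x_n)^\top \in \mathbb{DQ}^n$ by $$\|\mathbf{x}\|_2 = \sqrt{\sum_{i=1}^n |x_i|^2} \ \text{ if not all } x_i \text{ are infinitesimal}, \qquad \|\mathbf{x}\|_2 = \sqrt{\sum_{i=1}^n |(x_i)_{\mathcal{I}}|^2}\;\epsilon \ \text{ if all } x_i = (x_i)_{\mathcal{I}}\epsilon \text{ are infinitesimal},$$ is a norm on $\mathbb{DQ}^n$; that is: 1. for any $\mathbf{x} \in \mathbb{DQ}^n$, $\|\mathbf{x}\|_2 \ge 0$, and $\|\mathbf{x}\|_2 = 0$ if and only if $\mathbf{x} = \mathbf{0}$; 2. for any $\mathbf{x} \in \mathbb{DQ}^n$ and $q \in \mathbb{DQ}$, $\|q\mathbf{x}\|_2 = |q|\,\|\mathbf{x}\|_2$; 3. for any $\mathbf{x}, \mathbf{y} \in \mathbb{DQ}^n$, $\|\mathbf{x}+\mathbf{y}\|_2 \le \|\mathbf{x}\|_2 + \|\mathbf{y}\|_2$.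
   Context: Dual numbers: $\mathbb{D}$ is the set of $a = a_{st} + a_{\mathcal{I}}\epsilon$ with $a_{st}, a_{\mathcal{I}} \in \mathbb{R}$ and $\epsilon^2 = 0$, with componentwise addition and product $ab = a_{st}b_{st} + (a_{st}b_{\mathcal{I}} + a_{\mathcal{I}}b_{st})\epsilon$. Total order on $\mathbb{D}$: $a < b$ if $a_{st} < b_{st}$, or $a_{st} = b_{st}$ and $a_{\mathcal{I}} < b_{\mathcal{I}}$; $a \le b$ means $a<b$ or $a=b$. If $a\in\mathbb{D}$ has $a_{st} > 0$, then $\sqrt{a} = \sqrt{a_{st}} + \frac{a_{\mathcal{I}}}{2\sqrt{a_{st}}}\epsilon$; also $\sqrt{0}=0$. Quaternions: $\mathbb{Q}$ denotes the set of real (Hamilton) quaternions $q = q_0 + q_1\mathbf{i} + q_2\mathbf{j} + q_3\mathbf{k}$, with conjugate $q^* = q_0 - q_1\mathbf{i} - q_2\mathbf{j} - q_3\mathbf{k}$ and magnitude $|q| = \sqrt{q_0^2+q_1^2+q_2^2+q_3^2}$. Dual quaternions: $\mathbb{DQ}$ is the set of $q = q_{st} + q_{\mathcal{I}}\epsilon$ with $q_{st}, q_{\mathcal{I}} \in \mathbb{Q}$, where $\epsilon^2=0$ and $\epsilon$ commutes with quaternions; so $pq = p_{st}q_{st} + (p_{st}q_{\mathcal{I}} + p_{\mathcal{I}}q_{st})\epsilon$. $q$ is appreciable if $q_{st} \neq 0$ and infinitesimal if $q_{st} = 0$. The magnitude of $q \in \mathbb{DQ}$ is the dual number $$|q| =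 |q_{st}| + \frac{q_{st}q_{\mathcal{I}}^* + q_{\mathcal{I}}q_{st}^*}{2|q_{st}|}\epsilon \ \text{ if } q_{st} \neq 0, \qquad |q| = |q_{\mathcal{I}}|\epsilon \ \text{ if } q_{st} = 0$$ (the quaternion $q_{st}q_{\mathcal{I}}^* + q_{\mathcal{I}}q_{st}^*$ is real). $\mathbb{DQ}^n$ is the set of $n$-dimensional dual quaternion vectors, with componentwise addition and $q\mathbf{x} = (qx_1,\dots,qx_n)^\top$. *)

theory Defs
  imports "HOL-Analysis.Analysis"
begin

section \<open>Real quaternions\<close>

datatype quat = Quat (q0: real) (q1: real) (q2: real) (q3: real)

lemma quat_eq_iff: "p = q \<longleftrightarrow> q0 p = q0 q \<and> q1 p = q1 q \<and> q2 p = q2 q \<and> q3 p = q3 q"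
  by (cases p; cases q) simp

instantiation quat :: ring_1
begin

definition zero_quat :: quat
  where "0 = Quat 0 0 0 0"

definition one_quat :: quat
  where "1 = Quat 1 0 0 0"

definition plus_quat :: "quat \<Rightarrow> quat \<Rightarrow> quat"
  where "p + q = Quat (q0 p + q0 q) (q1 p + q1 q) (q2 p + q2 q) (q3 p + q3 q)"

definition minus_quat :: "quat \<Rightarrow> quat \<Rightarrow> quat"
  where "p - q = Quat (q0 p - q0 q) (q1 p - q1 q) (q2 p - q2 q) (q3 p - q3 q)"

definition uminus_quat :: "quat \<Rightarrow> quat"
  where "- q = Quat (- q0 q) (- q1 q) (- q2 q) (- q3 q)"

definition times_quat :: "quat \<Rightarrow> quat \<Rightarrow> quat"
  where "p * q = Quat
    (q0 p * q0 q - q1 p * q1 q - q2 p * q2 q - q3 p * q3 q)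
    (q0 p * q1 q + q1 p * q0 q + q2 p * q3 q - q3 p * q2 q)
    (q0 p * q2 q - q1 p * q3 q + q2 p * q0 q + q3 p * q1 q)
    (q0 p * q3 q + q1 p * q2 q - q2 p * q1 q + q3 p * q0 q)"

instance
  by standard (simp_all add: zero_quat_def one_quat_def plus_quat_def minus_quat_def
      uminus_quat_def times_quat_def quat_eq_iff algebra_simps)

end

definition quat_cnj :: "quat \<Rightarrow> quat"
  where "quat_cnj q = Quat (q0 q) (- q1 q) (- q2 q) (- q3 q)"

definition quat_mag :: "quat \<Rightarrow> real"
  where "quat_mag q = sqrt ((q0 q)\<^sup>2 + (q1 q)\<^sup>2 + (q2 q)\<^sup>2 + (q3 q)\<^sup>2)"


section \<open>Dual extension of a ring\<close>

text \<open>\<open>Dual a b\<close> stands for \<open>a + b \<epsilon>\<close>, where \<open>\<epsilon>\<^sup>2 = 0\<close> and \<open>\<epsilon>\<close> commutes with the elements of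
  the base ring. Dual numbers are \<open>real dual\<close>, dual quaternions are \<open>quat dual\<close>.\<close>

datatype 'a dual = Dual (st_part: 'a) (inf_part: 'a)

type_synonym dual_number = "real dual"
type_synonym dual_quat = "quat dual"

lemma dual_eq_iff: "a = b \<longleftrightarrow> st_part a = st_part b \<and> inf_part a = inf_part b"
  by (cases a; cases b) simp

instantiation dual :: (ring_1) ring_1
begin

definition zero_dual :: "'a dual"
  where "0 = Dual 0 0"

definition one_dual :: "'a dual"
  where "1 = Dual 1 0"

definition plus_dual :: "'a dual \<Rightarrow> 'a dual \<Rightarrow> 'a dual"
  where "a + b = Dual (st_part a + st_part b) (inf_part a + inf_part b)"

definition minus_dual :: "'a dual \<Rightarrow> 'a dual \<Rightarrow> 'a dual"
  where "a - b = Dual (st_part a - st_part b) (inf_part a - inf_part b)"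

definition uminus_dual :: "'a dual \<Rightarrow> 'a dual"
  where "- a = Dual (- st_part a) (- inf_part a)"

definition times_dual :: "'a dual \<Rightarrow> 'a dual \<Rightarrow> 'a dual"
  where "a * b = Dual (st_part a * st_part b)
    (st_part a * inf_part b + inf_part a * st_part b)"

instance
  by standard (simp_all add: zero_dual_def one_dual_def plus_dual_def minus_dual_def
      uminus_dual_def times_dual_def dual_eq_iff algebra_simps)

end

instance dual :: (comm_ring_1) comm_ring_1
  by standard (simp_all add: times_dual_def one_dual_def plus_dual_def dual_eq_iff algebra_simps)

instantiation dual :: (linorder) linorder
begin

definition less_dual :: "'a dual \<Rightarrow> 'a dual \<Rightarrow> bool"
  where "a < b \<longleftrightarrow> st_part a < st_part b \<or> st_part a = st_part b \<and> inf_part a < inf_part b"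

definition less_eq_dual :: "'a dual \<Rightarrow> 'a dual \<Rightarrow> bool"
  where "a \<le> b \<longleftrightarrow> a < b \<or> a = (b :: 'a dual)"

instance
  by standard (auto simp: less_eq_dual_def less_dual_def dual_eq_iff)

end

text \<open>The square root is only specified for \<open>a = 0\<close> and for positive standard part.\<close>

definition dual_sqrt :: "dual_number \<Rightarrow> dual_number"
  where "dual_sqrt a =
    (if st_part a > 0 then Dual (sqrt (st_part a)) (inf_part a / (2 * sqrt (st_part a)))
     else if a = 0 then 0
     else undefined)"


section \<open>Dual quaternions and dual quaternion vectors\<close>

abbreviation infinitesimal :: "dual_quat \<Rightarrow> bool"
  where "infinitesimal q \<equiv> st_part q = 0"

text \<open>The quaternion in the dual part of the magnitude is real, so it is identified with its
  real component.\<close>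

lemma quat_cross_real:
  "\<exists>r. p * quat_cnj q + q * quat_cnj p = Quat r 0 0 0"
  by (simp add: quat_eq_iff plus_quat_def times_quat_def quat_cnj_def algebra_simps)

definition dq_mag :: "dual_quat \<Rightarrow> dual_number"
  where "dq_mag q =
    (if \<not> infinitesimal q
     then Dual (quat_mag (st_part q))
       (q0 (st_part q * quat_cnj (inf_part q) + inf_part q * quat_cnj (st_part q))
         / (2 * quat_mag (st_part q)))
     else Dual 0 (quat_mag (inf_part q)))"

definition dq_norm2 :: "dual_quat ^ 'n \<Rightarrow> dual_number"
  where "dq_norm2 x =
    (if \<not> (\<forall>i. infinitesimal (x $ i))
     then dual_sqrt (\<Sum>i\<in>UNIV. (dq_mag (x $ i))\<^sup>2)
     else Dual 0 (sqrt (\<Sum>i\<in>UNIV. (quat_mag (inf_part (x $ i)))\<^sup>2)))"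

end

theory Submission
  imports Defs
begin

text \<open>
  Read a quaternion as a point of Euclidean 4-space, and the standard and dual parts of a vector
  \<open>x\<close> as two points \<open>s\<close> and \<open>d\<close> of the Euclidean space of dimension \<open>4n\<close>. Then
  \<open>\<parallel>x\<parallel>\<^sub>2\<close> depends on \<open>s\<close> and \<open>d\<close> only through the inner product: it is \<open>\<bar>s\<bar> + (\<langle>s,d\<rangle> / \<bar>s\<bar>) \<epsilon>\<close>
  when \<open>s \<noteq> 0\<close>, so that the dual part is the derivative of the Euclidean norm at \<open>s\<close> in the
  direction \<open>d\<close>, and \<open>\<bar>d\<bar> \<epsilon>\<close> when \<open>s = 0\<close>, where only the one-sided derivative exists. This is
  \<open>dual_norm s d\<close> below; the magnitude of one dual quaternion is the case of dimension 4.

  Positivity is immediate. For the triangle inequality the order is lexicographic, so the dual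
  parts matter only if \<open>\<bar>s + t\<bar> = \<bar>s\<bar> + \<bar>t\<bar>\<close>. If \<open>s\<close> and \<open>t\<close> are both nonzero, this equality means
  that they point in the same direction, the direction of \<open>s + t\<close>, and the dual parts then add up
  exactly. If one of them vanishes, the claim for the dual parts is the Cauchy--Schwarz
  inequality; if both do, it is the ordinary triangle inequality (\<open>dual_norm_triangle\<close>).

  Homogeneity rests on two polarised forms of \<open>\<bar>pq\<bar> = \<bar>p\<bar>\<bar>q\<bar>\<close>: with a common left or a common
  right factor, \<open>\<langle>ap, aq\<rangle> = \<bar>a\<bar>\<^sup>2 \<langle>p,q\<rangle>\<close> and \<open>\<langle>ap, bp\<rangle> = \<langle>a,b\<rangle> \<bar>p\<bar>\<^sup>2\<close>. For \<open>q = a + b\<epsilon>\<close> they give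
  \<open>\<langle>as, ad + bs\<rangle> = \<bar>a\<bar>\<^sup>2 \<langle>s,d\<rangle> + \<langle>a,b\<rangle> \<bar>s\<bar>\<^sup>2\<close>, which is the product rule contained in
  \<open>\<bar>q\<bar> \<parallel>x\<parallel>\<^sub>2\<close>.
\<close>

section \<open>The dual-number norm of a pair of vectors\<close>

definition dual_norm :: "'a::real_inner \<Rightarrow> 'a \<Rightarrow> dual_number"
  where "dual_norm s d = (if s \<noteq> 0 then Dual (norm s) (s \<bullet> d / norm s) else Dual 0 (norm d))"

lemma dual_norm_nonneg: "0 \<le> dual_norm s d"
  by (auto simp: dual_norm_def less_eq_dual_def less_dual_def zero_dual_def)

lemma dual_norm_eq_0_iff: "dual_norm s d = 0 \<longleftrightarrow> s = 0 \<and> d = 0"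
  by (auto simp: dual_norm_def zero_dual_def)

text \<open>Equality in the triangle inequality gives \<open>\<bar>s\<bar> t = \<bar>t\<bar> s\<close>; adding \<open>\<bar>s\<bar> s\<close> or \<open>\<bar>t\<bar> t\<close> makes
  \<open>s + t\<close> a positive multiple of \<open>s\<close> or of \<open>t\<close>.\<close>

lemma direction_add_eq:
  fixes s t :: "'a::real_inner"
  assumes "s \<noteq> 0" "t \<noteq> 0" "norm (s + t) = norm s + norm t"
  shows "(s + t) /\<^sub>R norm (s + t) = s /\<^sub>R norm s"
    and "(s + t) /\<^sub>R norm (s + t) = t /\<^sub>R norm t"
proof -
  have par: "norm s *\<^sub>R t = norm t *\<^sub>R s"
    using assms(3) by (simp add: norm_triangle_eq)
  have pos: "norm (s + t) > 0"
    unfolding assms(3) using assms(1,2) by (simp add: add_pos_pos)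
  have "s + t = (norm (s + t) / norm s) *\<^sub>R s"
    using par assms by (simp add: eq_vector_fraction_iff algebra_simps)
  then have "(s + t) /\<^sub>R norm (s + t) = ((norm (s + t) / norm s) *\<^sub>R s) /\<^sub>R norm (s + t)"
    by (rule arg_cong)
  then show "(s + t) /\<^sub>R norm (s + t) = s /\<^sub>R norm s"
    using pos by (simp add: divide_inverse)
  have "s + t = (norm (s + t) / norm t) *\<^sub>R t"
    using par assms by (simp add: eq_vector_fraction_iff algebra_simps)
  then have "(s + t) /\<^sub>R norm (s + t) = ((norm (s + t) / norm t) *\<^sub>R t) /\<^sub>R norm (s + t)"
    by (rule arg_cong)
  then show "(s + t) /\<^sub>R norm (s + t) = t /\<^sub>R norm t"
    using pos by (simp add: divide_inverse)
qed

lemma inner_div_norm_le: "s \<bullet> d / norm s \<le> norm d"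
  for s d :: "'a::real_inner"
  using norm_cauchy_schwarz[of s d] by (cases "s = 0") (simp_all add: field_simps)

lemma dual_norm_triangle:
  "dual_norm (s + t) (d + e) \<le> dual_norm s d + dual_norm t e"
proof (cases "s = 0 \<or> t = 0")
  case True
  then show ?thesis
    using inner_div_norm_le[of t d] inner_div_norm_le[of s e] norm_triangle_ineq[of d e]
    by (auto simp: dual_norm_def plus_dual_def less_eq_dual_def less_dual_def
        inner_add_right add_divide_distrib)
next
  case False
  show ?thesis
  proof (cases "norm (s + t) = norm s + norm t")
    case strict: False
    then have "norm (s + t) < norm s + norm t"
      using norm_triangle_ineq[of s t] by simp
    moreover have "0 < norm s + norm t"
      using False by (simp add: add_pos_pos)
    ultimately show ?thesis
      using False by (simp add: dual_norm_def plus_dual_def less_eq_dual_def less_dual_def)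
  next
    case eq: True
    have nz: "s + t \<noteq> 0"
      using eq False by (metis add_nonneg_eq_0_iff norm_eq_zero norm_ge_zero)
    \<comment> \<open>The dual part is the linear functional \<open>\<langle>u,_\<rangle>\<close>, with the same unit vector \<open>u\<close> for \<open>s\<close>, \<open>t\<close> and
      \<open>s + t\<close>, applied to \<open>d\<close>, \<open>e\<close> and \<open>d + e\<close>.\<close>
    let ?u = "(s + t) /\<^sub>R norm (s + t)"
    have "(s + t) \<bullet> (d + e) / norm (s + t) = ?u \<bullet> d + ?u \<bullet> e"
      by (simp add: inner_add_right divide_inverse_commute distrib_left)
    also have "\<dots> = (s /\<^sub>R norm s) \<bullet> d + (t /\<^sub>R norm t) \<bullet> e"
      using direction_add_eq[of s t] False eq by metis
    also have "\<dots> = s \<bullet> d / norm s + t \<bullet> e / norm t"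
      by (simp add: divide_inverse_commute)
    finally show ?thesis
      using False eq nz by (simp add: dual_norm_def plus_dual_def less_eq_dual_def)
  qed
qed


section \<open>Quaternions and quaternion vectors as Euclidean vectors\<close>

text \<open>Nested pairs of reals carry the Euclidean inner product, and so do vectors with entries of that
  type.\<close>

definition quat_coords :: "quat \<Rightarrow> real \<times> real \<times> real \<times> real"
  where "quat_coords q = (q0 q, q1 q, q2 q, q3 q)"

lemma quat_coords_0 [simp]: "quat_coords 0 = 0"
  by (simp add: quat_coords_def zero_quat_def zero_prod_def)

lemma quat_coords_eq_0_iff [simp]: "quat_coords q = 0 \<longleftrightarrow> q = 0"
  by (simp add: quat_coords_def zero_quat_def zero_prod_def quat_eq_iff)

lemma quat_coords_add: "quat_coords (p + q) = quat_coords p + quat_coords q"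
  by (simp add: quat_coords_def plus_quat_def)

lemma norm_quat_coords: "norm (quat_coords q) = quat_mag q"
  by (simp add: quat_coords_def quat_mag_def norm_Pair add.assoc)

lemma inner_quat_coords_mult_left:
  "quat_coords (a * p) \<bullet> quat_coords (a * q) = (quat_mag a)\<^sup>2 * (quat_coords p \<bullet> quat_coords q)"
  by (simp add: quat_coords_def quat_mag_def times_quat_def) algebra

lemma inner_quat_coords_mult_right:
  "quat_coords (a * p) \<bullet> quat_coords (b * p) = (quat_coords a \<bullet> quat_coords b) * (quat_mag p)\<^sup>2"
  by (simp add: quat_coords_def quat_mag_def times_quat_def) algebra

lemma dq_mag_eq_dual_norm:
  "dq_mag q = dual_norm (quat_coords (st_part q)) (quat_coords (inf_part q))"
proof -
  have "q0 (p * quat_cnj r + r * quat_cnj p) = 2 * (quat_coords p \<bullet> quat_coords r)" for p r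
    by (simp add: quat_coords_def times_quat_def quat_cnj_def plus_quat_def)
  then show ?thesis
    by (simp add: dq_mag_def dual_norm_def norm_quat_coords)
qed

definition vec_coords :: "quat ^ 'n \<Rightarrow> (real \<times> real \<times> real \<times> real) ^ 'n"
  where "vec_coords x = (\<chi> i. quat_coords (x $ i))"

definition st_vec :: "dual_quat ^ 'n \<Rightarrow> quat ^ 'n"
  where "st_vec x = (\<chi> i. st_part (x $ i))"

definition inf_vec :: "dual_quat ^ 'n \<Rightarrow> quat ^ 'n"
  where "inf_vec x = (\<chi> i. inf_part (x $ i))"

lemma vec_coords_eq_0_iff [simp]: "vec_coords x = 0 \<longleftrightarrow> x = 0"
  by (simp add: vec_coords_def vec_eq_iff)

lemma vec_coords_add: "vec_coords (x + y) = vec_coords x + vec_coords y"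
  by (simp add: vec_coords_def vec_eq_iff quat_coords_add)

lemma st_vec_eq_0_iff: "st_vec x = 0 \<longleftrightarrow> (\<forall>i. infinitesimal (x $ i))"
  by (simp add: st_vec_def vec_eq_iff)

lemma eq_0_iff_parts: "x = 0 \<longleftrightarrow> st_vec x = 0 \<and> inf_vec x = 0"
  by (auto simp: st_vec_def inf_vec_def vec_eq_iff dual_eq_iff zero_dual_def)

lemma st_vec_add: "st_vec (x + y) = st_vec x + st_vec y"
  by (simp add: st_vec_def vec_eq_iff plus_dual_def)

lemma inf_vec_add: "inf_vec (x + y) = inf_vec x + inf_vec y"
  by (simp add: inf_vec_def vec_eq_iff plus_dual_def)

lemma st_vec_scale: "st_vec (q *s x) = st_part q *s st_vec x"
  by (simp add: st_vec_def vec_eq_iff times_dual_def)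

lemma inf_vec_scale: "inf_vec (q *s x) = st_part q *s inf_vec x + inf_part q *s st_vec x"
  by (simp add: inf_vec_def st_vec_def vec_eq_iff times_dual_def)

lemma norm_vec_coords: "norm (vec_coords x) = sqrt (\<Sum>i\<in>UNIV. (quat_mag (x $ i))\<^sup>2)"
  by (simp add: vec_coords_def norm_vec_def L2_set_def norm_quat_coords)

lemma inner_vec_coords_scale_left:
  "vec_coords (a *s x) \<bullet> vec_coords (a *s y) = (quat_mag a)\<^sup>2 * (vec_coords x \<bullet> vec_coords y)"
  by (simp add: vec_coords_def inner_vec_def inner_quat_coords_mult_left sum_distrib_left)

lemma inner_vec_coords_scale_right:
  "vec_coords (a *s x) \<bullet> vec_coords (b *s x)
    = (quat_coords a \<bullet> quat_coords b) * (norm (vec_coords x))\<^sup>2"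
  unfolding norm_vec_coords
  by (simp add: vec_coords_def inner_vec_def inner_quat_coords_mult_right sum_distrib_left
      sum_nonneg)

lemma norm_vec_coords_scale: "norm (vec_coords (a *s x)) = quat_mag a * norm (vec_coords x)"
proof -
  have "(norm (vec_coords (a *s x)))\<^sup>2 = (quat_mag a * norm (vec_coords x))\<^sup>2"
    using inner_vec_coords_scale_left[of a x x]
    by (simp add: power2_norm_eq_inner power_mult_distrib)
  moreover have "0 \<le> quat_mag a"
    by (simp add: quat_mag_def)
  ultimately show ?thesis
    by simp
qed


section \<open>The 2-norm of a dual quaternion vector\<close>

text \<open>Squaring removes the case distinction, because \<open>(\<bar>d\<bar> \<epsilon>)\<^sup>2 = 0\<close>. Thus an appreciable vector may have
  some infinitesimal entries, and the squared magnitudes still sum to the standard and dual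
  parts \<open>\<bar>s\<bar>\<^sup>2\<close> and \<open>2\<langle>s,d\<rangle>\<close> of the whole vector.\<close>

lemma dual_norm_square: "(dual_norm s d)\<^sup>2 = Dual ((norm s)\<^sup>2) (2 * (s \<bullet> d))"
  by (simp add: dual_norm_def power2_eq_square times_dual_def)

lemma sum_Dual: "(\<Sum>i\<in>A. Dual (f i) (g i)) = Dual (\<Sum>i\<in>A. f i) (\<Sum>i\<in>A. g i)"
  by (induction A rule: infinite_finite_induct) (simp_all add: zero_dual_def plus_dual_def)

lemma dq_norm2_eq_dual_norm:
  "dq_norm2 x = dual_norm (vec_coords (st_vec x)) (vec_coords (inf_vec x))"
proof (cases "st_vec x = 0")
  case True
  then show ?thesis
    by (simp add: dq_norm2_def dual_norm_def norm_vec_coords inf_vec_def flip: st_vec_eq_0_iff)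
next
  case False
  let ?s = "vec_coords (st_vec x)" and ?d = "vec_coords (inf_vec x)"
  have "(norm ?s)\<^sup>2 = (\<Sum>i\<in>UNIV. (quat_mag (st_part (x $ i)))\<^sup>2)"
    by (simp add: norm_vec_coords st_vec_def sum_nonneg)
  moreover have
    "?s \<bullet> ?d = (\<Sum>i\<in>UNIV. quat_coords (st_part (x $ i)) \<bullet> quat_coords (inf_part (x $ i)))"
    by (simp add: inner_vec_def vec_coords_def st_vec_def inf_vec_def)
  ultimately have "(\<Sum>i\<in>UNIV. (dq_mag (x $ i))\<^sup>2) = Dual ((norm ?s)\<^sup>2) (2 * (?s \<bullet> ?d))"
    by (simp add: dq_mag_eq_dual_norm dual_norm_square sum_Dual norm_quat_coords
        sum_distrib_left)
  then show ?thesis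
    using False
    by (simp add: dq_norm2_def dual_norm_def dual_sqrt_def flip: st_vec_eq_0_iff)
qed

text \<open>If \<open>q\<close> or \<open>x\<close> is infinitesimal, then so is \<open>q x\<close>, and both sides are products of Euclidean norms
  times \<open>\<epsilon>\<close>, or zero. Otherwise \<open>q x\<close> is appreciable, because \<open>\<bar>as\<bar> = \<bar>a\<bar>\<bar>s\<bar>\<close>, and dividing the
  expansion of \<open>\<langle>as, ad + bs\<rangle>\<close> by \<open>\<bar>a\<bar>\<bar>s\<bar>\<close> leaves \<open>\<bar>a\<bar> (\<langle>s,d\<rangle>/\<bar>s\<bar>) + (\<langle>a,b\<rangle>/\<bar>a\<bar>) \<bar>s\<bar>\<close>.\<close>

lemma dq_norm2_scale: "dq_norm2 (q *s x) = dq_mag q * dq_norm2 x"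
proof -
  let ?a = "st_part q" and ?b = "inf_part q" and ?s = "st_vec x" and ?d = "inf_vec x"
  have mag_0: "quat_mag 0 = 0"
    by (simp flip: norm_quat_coords)
  have a_0: "quat_mag ?a = 0 \<longleftrightarrow> ?a = 0"
    by (simp flip: norm_quat_coords)
  have s_0: "norm (vec_coords ?s) = 0 \<longleftrightarrow> ?s = 0"
    by simp
  have as_0: "?a *s ?s = 0 \<longleftrightarrow> ?a = 0 \<or> ?s = 0"
    using norm_vec_coords_scale[of ?a ?s] a_0
    by (metis mult_eq_0_iff norm_eq_zero vec_coords_eq_0_iff)
  have inner: "vec_coords (?a *s ?s) \<bullet> vec_coords (?a *s ?d + ?b *s ?s)
      = (quat_mag ?a)\<^sup>2 * (vec_coords ?s \<bullet> vec_coords ?d)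
        + (quat_coords ?a \<bullet> quat_coords ?b) * (norm (vec_coords ?s))\<^sup>2"
    by (simp add: vec_coords_add inner_add_right inner_vec_coords_scale_left
        inner_vec_coords_scale_right)
  show ?thesis
  proof (cases "?a = 0 \<or> ?s = 0")
    case True
    then show ?thesis
      by (auto simp: dq_norm2_eq_dual_norm dq_mag_eq_dual_norm st_vec_scale inf_vec_scale
          dual_norm_def times_dual_def norm_vec_coords_scale norm_quat_coords mag_0)
  next
    case False
    then show ?thesis
      using a_0 s_0
      by (simp add: dq_norm2_eq_dual_norm dq_mag_eq_dual_norm st_vec_scale inf_vec_scale
          dual_norm_def times_dual_def as_0 inner norm_vec_coords_scale norm_quat_coords
          add_divide_distrib power2_eq_square)
  qed
qed

theorem theorem6p4:
  shows "(\<forall>x :: dual_quat ^ 'n. dq_norm2 x \<ge> 0 \<and> (dq_norm2 x = 0 \<longleftrightarrow> x = 0))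
    \<and> (\<forall>(x :: dual_quat ^ 'n) (q :: dual_quat). dq_norm2 (q *s x) = dq_mag q * dq_norm2 x)
    \<and> (\<forall>(x :: dual_quat ^ 'n) (y :: dual_quat ^ 'n).
         dq_norm2 (x + y) \<le> dq_norm2 x + dq_norm2 y)"
proof (intro conjI allI)
  fix x y :: "dual_quat ^ 'n" and q :: dual_quat
  show "dq_norm2 x \<ge> 0"
    by (simp add: dq_norm2_eq_dual_norm dual_norm_nonneg)
  show "dq_norm2 x = 0 \<longleftrightarrow> x = 0"
    by (simp add: dq_norm2_eq_dual_norm dual_norm_eq_0_iff eq_0_iff_parts)
  show "dq_norm2 (q *s x) = dq_mag q * dq_norm2 x"
    by (rule dq_norm2_scale)
  show "dq_norm2 (x + y) \<le> dq_norm2 x + dq_norm2 y"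
    by (simp add: dq_norm2_eq_dual_norm st_vec_add inf_vec_add vec_coords_add dual_norm_triangle)
qed

end
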